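(* For any integer $m\ge 1$, the space $\mathcal F_m$ is equal to the space of all entire functions $f:\mathbb C\to\mathbb C$ satisfying the condition $$\iint_{\mathbb C}|f(z)|^2K_m(|z|^2)\,dA(z)<\infty .$$ Moreover, the inner product of $\mathcal F_m$ is given by $$\frac1\pi\iint_{\mathbb C} f(z)\overline{g(z)}\,K_m(|z|^2)\,dA(z)=\sum_{n=0}^\infty f_n\overline{g_n}\,(n!)^m,\qquad f,g\in\mathcal F_m,$$ where $f(z)=\sum_{n=0}^\infty f_nz^n$ and $g(z)=\sum_{n=0}^\infty g_nz^n$, and $\mathcal F_m$ has the orthonormal basis $\left\{\frac{z^n}{(n!)^{m/2}}\right\}_{n=0}^\infty$.
   Context: For an integer $m\ge1$, $\mathcal F_m$ denotes the Hilbert space of entire functions $f(z)=\sum_{n=0}^\infty f_nz^n$ with $\sum_{n=0}^\infty|f_n|^2(n!)^m<\infty$, equipped with the inner product $\langle f,g\rangle_{\mathcal F_m}=\sum_{n=0}^\infty f_n\overline{g_n}(n!)^m$. It is the reproducing kernel Hilbert space with reproducing kernel $k_m(z,\omega)=\sum_{n=0}^\infty\frac{z^n\overline{\omega}^n}{(n!)^m}$. The Mellin convolution of two functions $f,g$ on $(0,\infty)$ is $(f*g)(x)=\int_0^\infty f\!\left(\frac xt\right)g(t)\frac{dt}{t}$, $x>0$. The kernels $K_m$ on $(0,\infty)$ are defined by $K_1(x)=e^{-x}$ and, for every integer $m>1$, $K_m=K_1*\cdots*K_1$, the function $K_1$ Mellin-convolved $m$ times with itself ($m$ factors). $dA(z)=dx\,dy$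 ($z=x+iy$) denotes Lebesgue area measure on $\mathbb C$. *)

theory Defs
  imports "HOL-Complex_Analysis.Complex_Analysis"
begin

definition taylor_coeff :: "(complex \<Rightarrow> complex) \<Rightarrow> nat \<Rightarrow> complex" where
  "taylor_coeff f n = (deriv ^^ n) f 0 / fact n"

definition fock_space :: "nat \<Rightarrow> (complex \<Rightarrow> complex) set" where
  "fock_space m = {f. f holomorphic_on UNIV \<and>
     summable (\<lambda>n. (cmod (taylor_coeff f n))\<^sup>2 * (fact n) ^ m)}"

definition fock_inner :: "nat \<Rightarrow> (complex \<Rightarrow> complex) \<Rightarrow> (complex \<Rightarrow> complex) \<Rightarrow> complex" where
  "fock_inner m f g = (\<Sum>n. taylor_coeff f n * cnj (taylor_coeff g n) * (fact n) ^ m)"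

definition mellin_conv :: "(real \<Rightarrow> real) \<Rightarrow> (real \<Rightarrow> real) \<Rightarrow> real \<Rightarrow> real" where
  "mellin_conv f g x = (LINT t:{0<..}|lborel. f (x / t) * g t / t)"

text \<open>Only arguments \<open>m \<ge> 1\<close> and \<open>x > 0\<close> are meaningful. The product of \<open>m\<close> factors is
  bracketed to the left. At \<open>x = 0\<close> the value is irrelevant: below, the kernel is evaluated
  at \<open>\<bar>z\<bar>\<^sup>2\<close> under an area integral, and \<open>{0}\<close> is a null set.\<close>

definition mellin_kernel :: "nat \<Rightarrow> real \<Rightarrow> real" where
  "mellin_kernel m = ((\<lambda>k. mellin_conv k (\<lambda>x. exp (- x))) ^^ (m - 1)) (\<lambda>x. exp (- x))"

text \<open>Orthonormal basis of a space \<open>H\<close> of complex functions with inner product \<open>ip\<close>: an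
  orthonormal sequence in \<open>H\<close> whose finite complex linear combinations are dense in \<open>H\<close> for
  the norm \<open>\<parallel>d\<parallel> = sqrt \<langle>d, d\<rangle>\<close>.\<close>

definition orthonormal_basis ::
  "('a \<Rightarrow> complex) set \<Rightarrow> (('a \<Rightarrow> complex) \<Rightarrow> ('a \<Rightarrow> complex) \<Rightarrow> complex)
    \<Rightarrow> (nat \<Rightarrow> 'a \<Rightarrow> complex) \<Rightarrow> bool" where
  "orthonormal_basis H ip e \<longleftrightarrow>
     range e \<subseteq> H \<and>
     (\<forall>i j. ip (e i) (e j) = (if i = j then 1 else 0)) \<and>
     (\<forall>f\<in>H. \<forall>\<epsilon>>0. \<exists>N c. let d = (\<lambda>z. f z - (\<Sum>n<N. c n * e n z))
        in sqrt (Re (ip d d)) < \<epsilon>)"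

text \<open>Sanity checks: the coefficients are those of the power series of \<open>f\<close>, the series defining
  \<open>fock_inner\<close> converges on \<open>fock_space\<close>, and \<open>fock_space\<close> is a linear space, so that the
  differences measured in \<open>orthonormal_basis\<close> stay inside it.\<close>

lemma taylor_coeff_sums:
  assumes "f holomorphic_on UNIV"
  shows "(\<lambda>n. taylor_coeff f n * z ^ n) sums f z"
proof -
  have "f holomorphic_on ball 0 (norm z + 1)"
    using assms holomorphic_on_subset by blast
  from holomorphic_power_series[OF this, of z] show ?thesis
    by (simp add: taylor_coeff_def)
qed

lemma fock_inner_summable:
  assumes "f \<in> fock_space m" "g \<in> fock_space m"
  shows "summable (\<lambda>n. taylor_coeff f n * cnj (taylor_coeff g n) * (fact n) ^ m)"
proof (rule summable_comparison_test')
  let ?a = "taylor_coeff f" and ?b = "taylor_coeff g"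
  show "summable (\<lambda>n. (cmod (?a n))\<^sup>2 * (fact n) ^ m + (cmod (?b n))\<^sup>2 * (fact n) ^ m)"
    using assms by (intro summable_add) (auto simp: fock_space_def)
  fix n :: nat assume "n \<ge> 0"
  have "cmod (?a n) * cmod (?b n) \<le> (cmod (?a n))\<^sup>2 + (cmod (?b n))\<^sup>2"
    using sum_squares_bound[of "cmod (?a n)" "cmod (?b n)"]
      mult_nonneg_nonneg[OF norm_ge_zero norm_ge_zero, of "?a n" "?b n"] by linarith
  then show "norm (?a n * cnj (?b n) * (fact n) ^ m)
      \<le> (cmod (?a n))\<^sup>2 * (fact n) ^ m + (cmod (?b n))\<^sup>2 * (fact n) ^ m"
    by (simp add: norm_mult norm_power flip: distrib_right)
qed

lemma fock_space_add:
  assumes "f \<in> fock_space m" "g \<in> fock_space m"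
  shows "(\<lambda>z. f z + g z) \<in> fock_space m"
proof -
  let ?a = "taylor_coeff f" and ?b = "taylor_coeff g"
  have hol: "f holomorphic_on UNIV" "g holomorphic_on UNIV"
    using assms by (auto simp: fock_space_def)
  have co: "taylor_coeff (\<lambda>z. f z + g z) n = ?a n + ?b n" for n
    unfolding taylor_coeff_def
    by (subst higher_deriv_add[OF hol]) (auto simp: add_divide_distrib)
  have "summable (\<lambda>n. (cmod (?a n + ?b n))\<^sup>2 * (fact n) ^ m)"
  proof (rule summable_comparison_test')
    show "summable (\<lambda>n. 2 * ((cmod (?a n))\<^sup>2 * (fact n) ^ m + (cmod (?b n))\<^sup>2 * (fact n) ^ m))"
      using assms by (intro summable_mult summable_add) (auto simp: fock_space_def)
    fix n :: nat assume "n \<ge> 0"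
    have "(cmod (?a n + ?b n))\<^sup>2 \<le> (cmod (?a n) + cmod (?b n))\<^sup>2"
      by (intro power_mono norm_triangle_ineq) auto
    also have "\<dots> \<le> 2 * ((cmod (?a n))\<^sup>2 + (cmod (?b n))\<^sup>2)"
      using sum_squares_bound[of "cmod (?a n)" "cmod (?b n)"] by (simp add: power2_sum)
    finally show "norm ((cmod (?a n + ?b n))\<^sup>2 * (fact n) ^ m)
        \<le> 2 * ((cmod (?a n))\<^sup>2 * (fact n) ^ m + (cmod (?b n))\<^sup>2 * (fact n) ^ m)"
      by (simp add: mult.assoc flip: distrib_right)
  qed
  then show ?thesis
    using hol by (auto simp: fock_space_def co intro: holomorphic_intros)
qed

lemma fock_space_cmult:
  assumes "f \<in> fock_space m"
  shows "(\<lambda>z. c * f z) \<in> fock_space m"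
proof -
  have hol: "f holomorphic_on UNIV"
    using assms by (auto simp: fock_space_def)
  have co: "taylor_coeff (\<lambda>z. c * f z) n = c * taylor_coeff f n" for n
    unfolding taylor_coeff_def by (subst higher_deriv_cmult[OF hol]) auto
  have "summable (\<lambda>n. (cmod c)\<^sup>2 * ((cmod (taylor_coeff f n))\<^sup>2 * (fact n) ^ m))"
    using assms by (intro summable_mult) (auto simp: fock_space_def)
  then show ?thesis
    using hol by (auto simp: fock_space_def co norm_mult power_mult_distrib mult.assoc
        intro: holomorphic_intros)
qed

end

theory Submission
  imports Defs "HOL-Probability.Distributions"
begin

text \<open>By Tonelli, the \<open>n\<close>-th moment over \<open>(0, \<infinity>)\<close> is multiplicative under Mellin convolution, so the
  moments of \<open>K\<^sub>m\<close> are \<open>(n!)\<^sup>m\<close>. Area measure is invariant under rotations, so in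
  \<open>\<integral> \<bar>f(z)\<bar>\<^sup>2 K\<^sub>m(\<bar>z\<bar>\<^sup>2) dA\<close> the factor \<open>\<bar>f\<bar>\<^sup>2\<close> may be replaced by its circular mean, which is
  \<open>\<Sum>n. \<bar>f\<^sub>n\<bar>\<^sup>2 \<bar>z\<bar>\<^sup>2\<^sup>n\<close> by Parseval; and the image of area measure under \<open>z \<mapsto> \<bar>z\<bar>\<^sup>2\<close> is \<open>\<pi>\<close> times
  Lebesgue measure on \<open>(0, \<infinity>)\<close>. Hence the integral equals \<open>\<pi> \<Sum>n. \<bar>f\<^sub>n\<bar>\<^sup>2 (n!)\<^sup>m\<close>, both sides being
  possibly infinite, which identifies the spaces; the inner products agree by polarization.\<close>

subsection \<open>Area measure on the complex plane\<close>

lemma borel_measurable_Complex [measurable]: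
  assumes "f \<in> borel_measurable M" "g \<in> borel_measurable M"
  shows "(\<lambda>x. Complex (f x) (g x)) \<in> borel_measurable M"
  using assms unfolding Complex_eq by measurable

text \<open>Lebesgue measure is determined by its values on open boxes, and under (x, y) -> x + iy
  such a box pulls back to a product of two intervals. This opens the way to iterated
  integrals.\<close>

lemma lborel_complex_eq:
  "(lborel :: complex measure) = distr (lborel \<Otimes>\<^sub>M lborel) borel (\<lambda>(x, y). Complex x y)"
proof (rule lborel_eqI)
  fix l u :: complex
  assume le: "\<And>b. b \<in> Basis \<Longrightarrow> l \<bullet> b \<le> u \<bullet> b"
  have vim: "(\<lambda>(x, y). Complex x y) -` box l u = {Re l<..<Re u} \<times> {Im l<..<Im u}"
    by (auto simp: in_box_complex_iff)
  have "Re l \<le> Re u" "Im l \<le> Im u"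
    using le[of 1] le[of \<i>] by (auto simp: Basis_complex_def)
  then show "emeasure (distr (lborel \<Otimes>\<^sub>M lborel) borel (\<lambda>(x, y). Complex x y)) (box l u)
      = (\<Prod>b\<in>Basis. (u - l) \<bullet> b)"
    by (subst emeasure_distr)
       (simp_all add: vim space_pair_measure lborel.emeasure_pair_measure_Times
          Basis_complex_def ennreal_mult)
qed simp

text \<open>Tonelli in both orders: a horizontal shear is handled with x innermost, a vertical one
  with y innermost.\<close>

lemma nn_integral_complex_iterated:
  assumes [measurable]: "f \<in> borel_measurable borel"
  shows "(\<integral>\<^sup>+z. f z \<partial>lborel) = (\<integral>\<^sup>+x. \<integral>\<^sup>+y. f (Complex x y) \<partial>lborel \<partial>lborel)"
    and "(\<integral>\<^sup>+z. f z \<partial>lborel) = (\<integral>\<^sup>+y. \<integral>\<^sup>+x. f (Complex x y) \<partial>lborel \<partial>lborel)"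
proof -
  have "(\<integral>\<^sup>+z. f z \<partial>lborel) = (\<integral>\<^sup>+p. f (Complex (fst p) (snd p)) \<partial>(lborel \<Otimes>\<^sub>M lborel))"
    by (subst lborel_complex_eq, subst nn_integral_distr) (simp_all add: case_prod_beta)
  then show 1: "(\<integral>\<^sup>+z. f z \<partial>lborel) = (\<integral>\<^sup>+x. \<integral>\<^sup>+y. f (Complex x y) \<partial>lborel \<partial>lborel)"
    by (subst (asm) lborel.nn_integral_fst[symmetric]) simp_all
  then show "(\<integral>\<^sup>+z. f z \<partial>lborel) = (\<integral>\<^sup>+y. \<integral>\<^sup>+x. f (Complex x y) \<partial>lborel \<partial>lborel)"
    by (subst lborel_pair.Fubini') (simp_all)
qed

section \<open>Invariance under shears and rotations\<close>

text \<open>With the other coordinate frozen, a shear is a translation of the line, so already the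
  inner integral is unchanged.\<close>

lemma nn_integral_complex_shear:
  fixes f :: "complex \<Rightarrow> ennreal"
  assumes [measurable]: "f \<in> borel_measurable borel"
  shows "(\<integral>\<^sup>+z. f (Complex (Re z + a * Im z) (Im z)) \<partial>lborel) = (\<integral>\<^sup>+z. f z \<partial>lborel)"
    and "(\<integral>\<^sup>+z. f (Complex (Re z) (Im z + a * Re z)) \<partial>lborel) = (\<integral>\<^sup>+z. f z \<partial>lborel)"
proof -
  have "(\<integral>\<^sup>+x. f (Complex (x + a * y) y) \<partial>lborel) = (\<integral>\<^sup>+x. f (Complex x y) \<partial>lborel)" for y
    by (subst (2) nn_integral_real_affine[where c = 1 and t = "a * y"]) (simp_all add: add.commute)
  then show "(\<integral>\<^sup>+z. f (Complex (Re z + a * Im z) (Im z)) \<partial>lborel) = (\<integral>\<^sup>+z. f z \<partial>lborel)"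
    by (simp add: nn_integral_complex_iterated(2))
  have "(\<integral>\<^sup>+y. f (Complex x (y + a * x)) \<partial>lborel) = (\<integral>\<^sup>+y. f (Complex x y) \<partial>lborel)" for x
    by (subst (2) nn_integral_real_affine[where c = 1 and t = "a * x"]) (simp_all add: add.commute)
  then show "(\<integral>\<^sup>+z. f (Complex (Re z) (Im z + a * Re z)) \<partial>lborel) = (\<integral>\<^sup>+z. f z \<partial>lborel)"
    by (simp add: nn_integral_complex_iterated(1))
qed

text \<open>A rotation with nonreal multiplier is a product of three shears; the only other
  nontrivial rotation is \<open>-1 = \<i>\<^sup>2\<close>.\<close>

lemma nn_integral_complex_rotate:
  fixes f :: "complex \<Rightarrow> ennreal"
  assumes [measurable]: "f \<in> borel_measurable borel" and "cmod c = 1"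
  shows "(\<integral>\<^sup>+z. f (c * z) \<partial>lborel) = (\<integral>\<^sup>+z. f z \<partial>lborel)"
proof -
  have nonreal: "(\<integral>\<^sup>+z. f (c * z) \<partial>lborel) = (\<integral>\<^sup>+z. f z \<partial>lborel)"
    if [measurable]: "f \<in> borel_measurable borel" and "cmod c = 1" "Im c \<noteq> 0"
    for c and f :: "complex \<Rightarrow> ennreal"
  proof -
    \<comment> \<open>For c = exp(i theta) this is -tan(theta/2), the parameter of two equal
      horizontal shears \<open>g\<close> placed around a vertical shear \<open>h\<close> with
      parameter \<open>Im c\<close>.\<close>
    define a where "a = (Re c - 1) / Im c"
    have a: "a * Im c = Re c - 1" using that by (simp add: a_def)
    have sq: "Re c * Re c + Im c * Im c = 1"
      using \<open>cmod c = 1\<close> by (metis cmod_power2 power2_eq_square power_one)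
    \<comment> \<open>The matrix of \<open>g h g\<close> has upper right entry 2a + a^2 Im c, which
      must be -Im c. After multiplication by the nonzero \<open>Im c\<close> this reduces to |c| =
      1.\<close>
    have "Im c * (2 * a + a * Im c * a) = Im c * (- Im c)"
      using a sq by algebra
    then have b: "2 * a + a * Im c * a = - Im c"
      by (rule iffD1[OF mult_left_cancel[OF \<open>Im c \<noteq> 0\<close>]])
    define g where "g = (\<lambda>z. Complex (Re z + a * Im z) (Im z))"
    define h where "h = (\<lambda>z. Complex (Re z) (Im z + Im c * Re z))"
    have [measurable]: "g \<in> borel_measurable borel" "h \<in> borel_measurable borel"
      unfolding g_def h_def by measurable
    have "c * z = g (h (g z))" for z
    proof (rule complex_eqI)
      show "Re (c * z) = Re (g (h (g z)))"
        unfolding g_def h_def using a b by simp algebra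
      show "Im (c * z) = Im (g (h (g z)))"
        unfolding g_def h_def using a by simp algebra
    qed
    then have "(\<integral>\<^sup>+z. f (c * z) \<partial>lborel) = (\<integral>\<^sup>+z. f (g (h (g z))) \<partial>lborel)"
      by simp
    also have "\<dots> = (\<integral>\<^sup>+z. f (g (h z)) \<partial>lborel)"
      using nn_integral_complex_shear(1)[of "\<lambda>z. f (g (h z))" a] by (simp add: g_def)
    also have "\<dots> = (\<integral>\<^sup>+z. f (g z) \<partial>lborel)"
      using nn_integral_complex_shear(2)[of "\<lambda>z. f (g z)" "Im c"] by (simp add: h_def)
    also have "\<dots> = (\<integral>\<^sup>+z. f z \<partial>lborel)"
      using nn_integral_complex_shear(1)[of f a] by (simp add: g_def)
    finally show ?thesis .
  qed
  consider "Im c \<noteq> 0" | "c = 1" | "c = -1"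
    using \<open>cmod c = 1\<close> cmod_power2[of c]
    by (cases "Im c = 0") (auto simp: complex_eq_iff power2_eq_1_iff)
  then show ?thesis
  proof cases
    case 1
    with assms nonreal show ?thesis by simp
  next
    case 2
    then show ?thesis by simp
  next
    case 3
    have "(\<integral>\<^sup>+z. f (\<i> * (\<i> * z)) \<partial>lborel) = (\<integral>\<^sup>+z. f (\<i> * z) \<partial>lborel)"
      by (rule nonreal[of "\<lambda>z. f (\<i> * z)"]) simp_all
    also have "\<dots> = (\<integral>\<^sup>+z. f z \<partial>lborel)"
      by (rule nonreal) simp_all
    finally show ?thesis using 3 by (simp flip: mult.assoc)
  qed
qed

text \<open>Polar coordinates for radial functions: the preimage of {..a} under |z|^2 is a disc of
  radius sqrt a, of area pi a. The half-lines form a generating family closed under intersection, so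
  these values determine the image measure.\<close>

lemma nn_integral_complex_norm_sq:
  fixes h :: "real \<Rightarrow> ennreal"
  assumes [measurable]: "h \<in> borel_measurable borel"
  shows "(\<integral>\<^sup>+z. h ((cmod z)\<^sup>2) \<partial>lborel) = ennreal pi * (\<integral>\<^sup>+x\<in>{0<..}. h x \<partial>lborel)"
proof -
  let ?M = "distr lborel borel (\<lambda>z::complex. (cmod z)\<^sup>2)"
  let ?N = "density lborel (\<lambda>x. ennreal pi * indicator {0<..} x) :: real measure"
  have M: "emeasure ?M {..a} = (if a < 0 then 0 else ennreal (pi * a))" for a
  proof -
    have "(\<lambda>z::complex. (cmod z)\<^sup>2) -` {..a} = (if a < 0 then {} else cball 0 (sqrt a))"
    proof (cases "a < 0")
      case True
      then show ?thesis by (auto dest: order.trans[OF zero_le_power2])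
    next
      case False
      have "(cmod z)\<^sup>2 \<le> a \<longleftrightarrow> cmod z \<le> sqrt a" for z
        using False real_le_rsqrt[of "cmod z" a] real_sqrt_le_iff[of "(cmod z)\<^sup>2" a]
        by auto
      with False show ?thesis by auto
    qed
    then show ?thesis
      by (subst emeasure_distr) (auto simp: emeasure_cball unit_ball_vol_2)
  qed
  have N: "emeasure ?N {..a} = (if a < 0 then 0 else ennreal (pi * a))" for a
  proof -
    have "emeasure ?N {..a} = (\<integral>\<^sup>+x. ennreal pi * indicator {0<..a} x \<partial>lborel)"
      by (subst emeasure_density) (auto intro!: nn_integral_cong split: split_indicator)
    also have "\<dots> = ennreal pi * emeasure lborel {0<..a}"
      by (simp add: nn_integral_cmult)
    finally show ?thesis
      by (auto simp: ennreal_mult not_less)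
  qed
  have "?M = ?N"
  proof (rule measure_eqI_generator_eq[where E = "range (\<lambda>a. {..a::real})" and \<Omega> = UNIV
        and A = "\<lambda>n. {..real n}"])
    show "Int_stable (range (\<lambda>a. {..a::real}))"
      by (auto simp: Int_stable_def)
    show "(\<Union>n. {..real n}) = UNIV"
      using real_arch_simple by auto
  qed (use M N in \<open>auto simp: borel_eq_atMost\<close>)
  then have "(\<integral>\<^sup>+x. h x \<partial>?M) = (\<integral>\<^sup>+x. h x \<partial>?N)"
    by simp
  also have "\<dots> = (\<integral>\<^sup>+x. ennreal pi * (h x * indicator {0<..} x) \<partial>lborel)"
    by (subst nn_integral_density) (auto intro!: nn_integral_cong simp: mult_ac)
  finally show ?thesis
    by (simp add: nn_integral_distr nn_integral_cmult)
qed

subsection \<open>Moments of the Mellin kernels\<close>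

lemma mellin_conv_measurable [measurable]:
  assumes [measurable]: "f \<in> borel_measurable borel" "g \<in> borel_measurable borel"
  shows "mellin_conv f g \<in> borel_measurable borel"
  unfolding mellin_conv_def set_lebesgue_integral_def by measurable

lemma mellin_conv_nonneg:
  assumes "\<And>x. f x \<ge> 0" "\<And>x. g x \<ge> 0"
  shows "mellin_conv f g x \<ge> 0"
  unfolding mellin_conv_def set_lebesgue_integral_def
  by (intro integral_nonneg_AE AE_I2) (auto simp: assms indicator_def)

text \<open>Junk values of \<open>mellin_conv\<close> can occur only where the convolution integral diverges;
  finiteness of the \<open>n\<close>-th moments makes that a null set.\<close>

lemma nn_integral_mellin_conv_moment:
  assumes [measurable]: "f \<in> borel_measurable borel" "g \<in> borel_measurable borel"
    and f0: "\<And>x. f x \<ge> 0" and g0: "\<And>x. g x \<ge> 0"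
    and f: "(\<integral>\<^sup>+x\<in>{0<..}. ennreal (x ^ n * f x) \<partial>lborel) = A" "A < \<infinity>"
    and g: "(\<integral>\<^sup>+x\<in>{0<..}. ennreal (x ^ n * g x) \<partial>lborel) = B" "B < \<infinity>"
  shows "(\<integral>\<^sup>+x\<in>{0<..}. ennreal (x ^ n * mellin_conv f g x) \<partial>lborel) = A * B"
proof -
  \<comment> \<open>\<open>F\<close> is the integrand of \<open>mellin_conv\<close> and
    \<open>N\<close> its integral in [0, \<infinity>], which always exists. Tonelli is applied to
    \<open>N\<close>; the comparison with the Bochner integral comes afterwards.\<close>
  define F where "F x t = indicator {0<..} t *\<^sub>R (f (x / t) * g t / t)" for x t :: real
  define N where "N x = (\<integral>\<^sup>+t. ennreal (F x t) \<partial>lborel)" for x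
  have [measurable]: "(\<lambda>p. F (fst p) (snd p)) \<in> borel_measurable (lborel \<Otimes>\<^sub>M lborel)"
    unfolding F_def by measurable
  have [measurable]: "F x \<in> borel_measurable borel" "(\<lambda>x. F x t) \<in> borel_measurable borel" for x t
    unfolding F_def by measurable
  have [measurable]: "N \<in> borel_measurable lborel"
    unfolding N_def by measurable
  have F0: "F x t \<ge> 0" for x t
    unfolding F_def using f0[of "x / t"] g0[of t] by (cases "t > 0") simp_all
  have inner: "(\<integral>\<^sup>+x\<in>{0<..}. ennreal (x ^ n * F x t) \<partial>lborel)
      = A * (ennreal (t ^ n * g t) * indicator {0<..} t)" for t
  proof (cases "t > 0")
    case True
    \<comment> \<open>Substituting t * x for x turns f (x / t) into f x and x^n into t^n x^n. The
      factor t from the substitution cancels the 1 / t of the measure dt / t.\<close>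
    define c where "c = t ^ n * g t / t"
    have c: "c \<ge> 0" "t * c = t ^ n * g t"
      using True g0 by (simp_all add: c_def)
    have eq: "ennreal ((t * x) ^ n * F (t * x) t) * indicator {0<..} (t * x)
        = ennreal c * (ennreal (x ^ n * f x) * indicator {0<..} x)" for x
    proof (cases "x > 0")
      case x: True
      have "(t * x) ^ n * F (t * x) t = c * (x ^ n * f x)"
        using True by (simp add: F_def c_def power_mult_distrib)
      with True x c show ?thesis
        by (simp add: ennreal_mult')
    next
      case False
      with True show ?thesis
        by (simp add: zero_less_mult_iff)
    qed
    have "(\<integral>\<^sup>+x\<in>{0<..}. ennreal (x ^ n * F x t) \<partial>lborel)
        = ennreal t * (\<integral>\<^sup>+x. ennreal ((t * x) ^ n * F (t * x) t) * indicator {0<..} (t * x) \<partial>lborel)"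
      using True by (subst nn_integral_real_affine[where c = t and t = 0]) simp_all
    also have "\<dots> = ennreal t * (ennreal c * A)"
      unfolding eq by (subst nn_integral_cmult) (simp_all only: f, measurable)
    also have "\<dots> = A * ennreal (t * c)"
      unfolding ennreal_mult[OF less_imp_le[OF True] c(1)] by (simp only: mult_ac)
    also have "\<dots> = A * ennreal (t ^ n * g t)"
      by (simp only: c)
    finally show ?thesis using True by simp
  qed (simp add: F_def)
  have moment: "(\<integral>\<^sup>+x\<in>{0<..}. ennreal (x ^ n) * N x \<partial>lborel) = A * B"
  proof -
    have "(\<integral>\<^sup>+x\<in>{0<..}. ennreal (x ^ n) * N x \<partial>lborel)
        = (\<integral>\<^sup>+x. \<integral>\<^sup>+t. ennreal (x ^ n * F x t) * indicator {0<..} x \<partial>lborel \<partial>lborel)"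
    proof (rule nn_integral_cong)
      fix x :: real
      have "(\<integral>\<^sup>+t. ennreal (x ^ n * F x t) * indicator {0<..} x \<partial>lborel)
          = (\<integral>\<^sup>+t. (ennreal (x ^ n) * indicator {0<..} x) * ennreal (F x t) \<partial>lborel)"
        by (intro nn_integral_cong) (simp add: ennreal_mult' F0 mult_ac split: split_indicator)
      also have "\<dots> = ennreal (x ^ n) * N x * indicator {0<..} x"
        by (subst nn_integral_cmult) (simp_all add: N_def mult_ac)
      finally show "ennreal (x ^ n) * N x * indicator {0<..} x
          = (\<integral>\<^sup>+t. ennreal (x ^ n * F x t) * indicator {0<..} x \<partial>lborel)" ..
    qed
    also have "\<dots> = (\<integral>\<^sup>+t. \<integral>\<^sup>+x. ennreal (x ^ n * F x t) * indicator {0<..} x \<partial>lborel \<partial>lborel)"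
    proof (rule lborel_pair.Fubini')
      have [measurable]: "(\<lambda>(x, t). F t x) \<in> borel_measurable (lborel \<Otimes>\<^sub>M lborel)"
        unfolding F_def by measurable
      show "(\<lambda>(t, x). ennreal (x ^ n * F x t) * indicator {0<..} x)
          \<in> borel_measurable (lborel \<Otimes>\<^sub>M lborel)"
        by measurable
    qed
    also have "\<dots> = (\<integral>\<^sup>+t. A * (ennreal (t ^ n * g t) * indicator {0<..} t) \<partial>lborel)"
      by (simp add: inner)
    also have "\<dots> = A * B"
      by (subst nn_integral_cmult) (simp_all add: g)
    finally show ?thesis .
  qed
  have "AE x in lborel. ennreal (x ^ n) * N x * indicator {0<..} x \<noteq> \<infinity>"
    by (rule nn_integral_noteq_infinite)
       (use moment f g in \<open>auto simp: ennreal_mult_eq_top_iff less_top\<close>)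
  then have "AE x in lborel. x > 0 \<longrightarrow> ennreal (mellin_conv f g x) = N x"
  proof (rule AE_mp, intro AE_I2 impI)
    fix x :: real
    assume "x > 0" and "ennreal (x ^ n) * N x * indicator {0<..} x \<noteq> \<infinity>"
    \<comment> \<open>As x^n > 0, finiteness of the product forces finiteness of its factor
      \<open>N x\<close>.\<close>
    then have fin: "N x < \<infinity>"
      by (auto simp: ennreal_mult_eq_top_iff less_top)
    have "integrable lborel (F x)"
      using fin by (intro integrableI_nonneg) (auto simp: F0 N_def)
    from nn_integral_eq_integral[OF this AE_I2[OF F0]] show "ennreal (mellin_conv f g x) = N x"
      by (simp only: mellin_conv_def set_lebesgue_integral_def N_def F_def)
  qed
  then have "AE x in lborel. ennreal (x ^ n * mellin_conv f g x) * indicator {0<..} x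
      = ennreal (x ^ n) * N x * indicator {0<..} x"
  proof eventually_elim
    fix x :: real
    assume "x > 0 \<longrightarrow> ennreal (mellin_conv f g x) = N x"
    then show "ennreal (x ^ n * mellin_conv f g x) * indicator {0<..} x
        = ennreal (x ^ n) * N x * indicator {0<..} x"
      by (cases "x > 0") (simp_all add: ennreal_mult mellin_conv_nonneg f0 g0)
  qed
  then have "(\<integral>\<^sup>+x\<in>{0<..}. ennreal (x ^ n * mellin_conv f g x) \<partial>lborel)
      = (\<integral>\<^sup>+x\<in>{0<..}. ennreal (x ^ n) * N x \<partial>lborel)"
    by (rule nn_integral_cong_AE)
  with moment show ?thesis by simp
qed

section \<open>Sign, measurability and moments of the iterated kernels\<close>

text \<open>The recursion starts at index 1: by truncated subtraction, indices 0 and 1 both give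
  exp(-x). Hence the inductions below run over \<open>Suc k\<close>.\<close>

lemma mellin_kernel_Suc_Suc:
  "mellin_kernel (Suc (Suc m)) = mellin_conv (mellin_kernel (Suc m)) (\<lambda>x. exp (- x))"
  by (simp add: mellin_kernel_def)

lemma mellin_kernel_nonneg: "mellin_kernel m x \<ge> 0"
proof (cases m)
  case (Suc k)
  have "mellin_kernel (Suc k) x \<ge> 0" for x
  proof (induction k arbitrary: x)
    case (Suc k)
    then show ?case
      by (simp add: mellin_kernel_Suc_Suc mellin_conv_nonneg)
  qed (simp add: mellin_kernel_def)
  with Suc show ?thesis by simp
qed (simp add: mellin_kernel_def)

lemma borel_measurable_mellin_kernel [measurable]: "mellin_kernel m \<in> borel_measurable borel"
proof (cases m)
  case (Suc k)
  have "mellin_kernel (Suc k) \<in> borel_measurable borel"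
    by (induction k) (simp_all add: mellin_kernel_Suc_Suc, simp add: mellin_kernel_def)
  with Suc show ?thesis by simp
qed (simp add: mellin_kernel_def)

lemma nn_integral_exp_moment:
  "(\<integral>\<^sup>+x\<in>{0<..}. ennreal (x ^ n * exp (- x)) \<partial>lborel) = ennreal (fact n)"
proof -
  \<comment> \<open>The Gamma integral is taken over the closed half-line, which differs by a null
    set.\<close>
  have "AE x in lborel. ennreal (x ^ n * exp (- x)) * indicator {0<..} x
      = ennreal (x ^ n * exp (- x)) * indicator {0..} x"
    using AE_lborel_singleton[of "0::real"] by eventually_elim (simp split: split_indicator)
  then have "(\<integral>\<^sup>+x\<in>{0<..}. ennreal (x ^ n * exp (- x)) \<partial>lborel)
      = (\<integral>\<^sup>+x\<in>{0..}. ennreal (x ^ n * exp (- x)) \<partial>lborel)"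
    by (rule nn_integral_cong_AE)
  then show ?thesis
    by (simp only: nn_intergal_power_times_exp_Ici) simp
qed

text \<open>Each further convolution with exp(-x) multiplies the n-th moment by n!. The induction
  hypothesis also provides the finiteness that multiplicativity of moments requires.\<close>

lemma nn_integral_mellin_kernel_moment:
  assumes "m \<ge> 1"
  shows "(\<integral>\<^sup>+x\<in>{0<..}. ennreal (x ^ n * mellin_kernel m x) \<partial>lborel) = ennreal (fact n ^ m)"
proof -
  have "(\<integral>\<^sup>+x\<in>{0<..}. ennreal (x ^ n * mellin_kernel (Suc k) x) \<partial>lborel)
      = ennreal (fact n ^ Suc k)" for k
  proof (induction k)
    case 0
    show ?case
      by (simp add: mellin_kernel_def nn_integral_exp_moment)
  next
    case (Suc k)
    show ?case
      unfolding mellin_kernel_Suc_Suc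
      by (subst nn_integral_mellin_conv_moment[OF _ _ _ _ Suc _ nn_integral_exp_moment])
         (auto simp: mellin_kernel_nonneg ennreal_mult ennreal_mult_less_top power_Suc2 simp del: power_Suc)
  qed
  from this[of "m - 1"] assms show ?thesis by simp
qed

subsection \<open>Parseval on the circle\<close>

text \<open>Orthogonality of the characters of the circle: for k \<noteq> 0 the primitive
  \<open>F\<close> has period 2 pi on the real line, so its values at the endpoints cancel.\<close>

lemma has_integral_cis_int:
  fixes k :: int
  shows "((\<lambda>t. cis (of_int k * t)) has_integral (if k = 0 then of_real (2 * pi) else 0)) {0..2*pi}"
proof (cases "k = 0")
  case True
  then show ?thesis
    using has_integral_const_real[of "1::complex" 0 "2*pi"] by (simp add: scaleR_conv_of_real)
next
  case False
  define F where "F z = exp (\<i> * of_int k * z) / (\<i> * of_int k)" for z :: complex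
  have "((\<lambda>t. F (of_real t)) has_vector_derivative cis (of_int k * t)) (at t within {0..2*pi})" for t
  proof (rule has_vector_derivative_real_field)
    show "(F has_field_derivative cis (of_int k * t)) (at (of_real t))"
      unfolding F_def using False
      by (auto intro!: derivative_eq_intros simp: cis_conv_exp mult_ac)
  qed
  then have "((\<lambda>t. cis (of_int k * t)) has_integral (F (of_real (2*pi)) - F (of_real 0))) {0..2*pi}"
    by (intro fundamental_theorem_of_calculus) auto
  moreover have "exp (\<i> * of_int k * of_real (2*pi)) = 1"
    using exp_integer_2pi[of "of_int k"] by (simp add: mult_ac)
  ultimately show ?thesis
    using False by (simp add: F_def)
qed

text \<open>The squared modulus expands into a double sum of characters, of which only the diagonal
  survives integration. The frequencies are integer differences because i - j may be
  negative.\<close>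

lemma has_integral_norm_sq_trig_poly:
  fixes a :: "nat \<Rightarrow> complex"
  shows "((\<lambda>t. (cmod (\<Sum>n<N. a n * cis (real n * t)))\<^sup>2) has_integral
    (2 * pi * (\<Sum>n<N. (cmod (a n))\<^sup>2))) {0..2*pi}"
proof -
  have "((\<lambda>t. \<Sum>i<N. \<Sum>j<N. a i * cnj (a j) * cis (of_int (int i - int j) * t)) has_integral
      (\<Sum>i<N. \<Sum>j<N. a i * cnj (a j) * (if int i - int j = 0 then of_real (2 * pi) else 0))) {0..2*pi}"
    by (intro has_integral_sum has_integral_mult_right has_integral_cis_int) auto
  moreover have "(\<Sum>i<N. \<Sum>j<N. a i * cnj (a j) * (if int i - int j = 0 then of_real (2 * pi) else 0))
      = of_real (2 * pi * (\<Sum>n<N. (cmod (a n))\<^sup>2))"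
  proof -
    have "(\<Sum>j<N. a i * cnj (a j) * (if int i - int j = 0 then of_real (2 * pi) else 0))
        = of_real (2 * pi * (cmod (a i))\<^sup>2)" if "i < N" for i
    proof -
      have "(\<Sum>j<N. a i * cnj (a j) * (if int i - int j = 0 then of_real (2 * pi) else 0))
          = (\<Sum>j<N. if i = j then a i * cnj (a i) * of_real (2 * pi) else 0)"
        by (intro sum.cong) auto
      also have "\<dots> = of_real (2 * pi * (cmod (a i))\<^sup>2)"
        using that by (simp only: sum.delta' finite_lessThan lessThan_iff if_True
            complex_norm_square of_real_mult mult.commute)
      finally show ?thesis .
    qed
    then show ?thesis
      by (simp add: sum_distrib_left)
  qed
  moreover have "(\<Sum>i<N. \<Sum>j<N. a i * cnj (a j) * cis (of_int (int i - int j) * t))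
      = of_real ((cmod (\<Sum>n<N. a n * cis (real n * t)))\<^sup>2)" for t
    unfolding complex_norm_square cnj_sum sum_product
    by (intro sum.cong refl) (simp add: cis_cnj cis_mult algebra_simps)
  ultimately have "((\<lambda>t. complex_of_real ((cmod (\<Sum>n<N. a n * cis (real n * t)))\<^sup>2)) has_integral
      of_real (2 * pi * (\<Sum>n<N. (cmod (a n))\<^sup>2))) {0..2*pi}"
    by (simp only:)
  from has_integral_Re[OF this] show ?thesis by simp
qed

text \<open>Limit of the polynomial case by dominated convergence: the squared partial sums are
  bounded by the constant (\<Sum>n. |a n|)^2.\<close>

lemma nn_integral_norm_sq_trig_series:
  fixes a :: "nat \<Rightarrow> complex"
  assumes a: "summable (\<lambda>n. cmod (a n))"
  shows "(\<integral>\<^sup>+t\<in>{0..2*pi}. ennreal ((cmod (\<Sum>n. a n * cis (real n * t)))\<^sup>2) \<partial>lborel)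
    = ennreal (2 * pi) * (\<Sum>n. ennreal ((cmod (a n))\<^sup>2))"
proof -
  define S where "S N t = (cmod (\<Sum>n<N. a n * cis (real n * t)))\<^sup>2" for N t
  define T where "T t = (cmod (\<Sum>n. a n * cis (real n * t)))\<^sup>2" for t
  have S: "(S N has_integral (2 * pi * (\<Sum>n<N. (cmod (a n))\<^sup>2))) {0..2*pi}" for N
    unfolding S_def by (rule has_integral_norm_sq_trig_poly)
  have bound: "norm (S N t) \<le> (\<Sum>n. cmod (a n))\<^sup>2" for N t
  proof -
    have "cmod (\<Sum>n<N. a n * cis (real n * t)) \<le> (\<Sum>n<N. cmod (a n))"
      by (intro order.trans[OF norm_sum]) (simp add: norm_mult)
    also have "\<dots> \<le> (\<Sum>n. cmod (a n))"
      using a by (intro sum_le_suminf) auto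
    finally show ?thesis
      by (simp add: S_def power_mono)
  qed
  have "summable (\<lambda>n. a n * cis (real n * t))" for t
    by (rule summable_norm_cancel) (simp add: norm_mult a)
  then have lim: "(\<lambda>N. S N t) \<longlonglongrightarrow> T t" for t
    unfolding S_def T_def by (intro tendsto_intros summable_LIMSEQ)
  have T: "T integrable_on {0..2*pi}"
    and conv: "(\<lambda>N. integral {0..2*pi} (S N)) \<longlonglongrightarrow> integral {0..2*pi} T"
    using dominated_convergence[of S "{0..2*pi}" "\<lambda>_. (\<Sum>n. cmod (a n))\<^sup>2" T]
      bound lim S by blast+
  \<comment> \<open>Division by 2 pi exposes the partial sums of |a n|^2, so their convergence and
    their limit come out together.\<close>
  have "(\<lambda>N. (2 * pi * (\<Sum>n<N. (cmod (a n))\<^sup>2)) / (2 * pi)) \<longlonglongrightarrow> integral {0..2*pi} T / (2 * pi)"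
    using conv by (intro tendsto_divide tendsto_const) (simp_all add: integral_unique[OF S])
  then have sums: "(\<lambda>n. (cmod (a n))\<^sup>2) sums (integral {0..2*pi} T / (2 * pi))"
    by (simp add: sums_def)
  have "(\<integral>\<^sup>+t\<in>{0..2*pi}. ennreal (T t) \<partial>lborel) = ennreal (integral {0..2*pi} T)"
    by (rule nn_integral_has_integral_lebesgue'[OF _ integrable_integral[OF T]]) (simp add: T_def)
  also have "\<dots> = ennreal (2 * pi) * (\<Sum>n. ennreal ((cmod (a n))\<^sup>2))"
    using sums by (subst suminf_ennreal2) (auto simp: sums_iff simp flip: ennreal_mult')
  finally show ?thesis by (simp add: T_def)
qed

section \<open>Entire functions on circles and their weighted area integrals\<close>

lemma borel_measurable_entire:
  fixes f :: "complex \<Rightarrow> complex"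
  assumes "f holomorphic_on UNIV"
  shows "f \<in> borel_measurable borel"
  using assms by (intro borel_measurable_continuous_onI holomorphic_on_imp_continuous_on)

lemma nn_integral_circle_parseval:
  assumes f: "f holomorphic_on UNIV"
  shows "(\<integral>\<^sup>+t\<in>{0..2*pi}. ennreal ((cmod (f (cis t * z)))\<^sup>2) \<partial>lborel)
    = ennreal (2 * pi) * (\<Sum>n. ennreal ((cmod (taylor_coeff f n))\<^sup>2 * ((cmod z)\<^sup>2) ^ n))"
proof -
  let ?a = "\<lambda>n. taylor_coeff f n * z ^ n"
  \<comment> \<open>Convergence at the larger radius |z| + 1 gives absolute convergence at
    z.\<close>
  have "summable (\<lambda>n. taylor_coeff f n * of_real (cmod z + 1) ^ n)"
    using taylor_coeff_sums[OF f] by (rule sums_summable)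
  then have a: "summable (\<lambda>n. cmod (?a n))"
    by (rule powser_insidea) (simp add: norm_of_real)
  have eq: "taylor_coeff f n * (cis t * z) ^ n = ?a n * cis (real n * t)" for n t
    by (simp add: power_mult_distrib Complex.DeMoivre mult.commute[of "z ^ n"] mult.assoc)
  have "f (cis t * z) = (\<Sum>n. ?a n * cis (real n * t))" for t
    using sums_unique[OF taylor_coeff_sums[OF f, of "cis t * z"]] unfolding eq .
  moreover have "(cmod (?a n))\<^sup>2 = (cmod (taylor_coeff f n))\<^sup>2 * ((cmod z)\<^sup>2) ^ n" for n
    by (simp add: norm_mult norm_power power_mult_distrib mult.commute flip: power_mult)
  ultimately show ?thesis
    using nn_integral_norm_sq_trig_series[OF a] by simp
qed

text \<open>The double integral of \<open>?G\<close> over t and z is computed in both orders. With z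
  innermost, rotation invariance yields 2 pi \<open>?I\<close>; with t innermost, Parseval on each
  circle leaves powers of |z|^2, whose integrals against the kernel are pi (n!)^m.\<close>

lemma nn_integral_mellin_kernel_norm_sq:
  assumes m: "m \<ge> 1" and f: "f holomorphic_on UNIV"
  shows "(\<integral>\<^sup>+z. ennreal ((cmod (f z))\<^sup>2 * mellin_kernel m ((cmod z)\<^sup>2)) \<partial>lborel)
    = ennreal pi * (\<Sum>n. ennreal ((cmod (taylor_coeff f n))\<^sup>2 * fact n ^ m))"
    (is "?I = _ * suminf ?c")
proof -
  define K where "K z = mellin_kernel m ((cmod z)\<^sup>2)" for z :: complex
  have [measurable]: "K \<in> borel_measurable borel"
    unfolding K_def by measurable
  have K0: "K z \<ge> 0" for z
    by (simp add: K_def mellin_kernel_nonneg)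
  have [measurable]: "f \<in> borel_measurable borel"
    by (rule borel_measurable_entire[OF f])
  have [measurable]: "cis \<in> borel_measurable borel"
    by (intro borel_measurable_continuous_onI continuous_intros)
  let ?G = "\<lambda>t z. ennreal ((cmod (f (cis t * z)))\<^sup>2 * K z) * indicator {0..2*pi} t"
  have rot: "(\<integral>\<^sup>+z. ?G t z \<partial>lborel) = ?I * indicator {0..2*pi} t" for t
  proof -
    \<comment> \<open>The weight is radial, so \<open>K z\<close> may be replaced by
      \<open>K (cis t * z)\<close> before rotating.\<close>
    have "(\<integral>\<^sup>+z. ?G t z \<partial>lborel)
        = (\<integral>\<^sup>+z. ennreal ((cmod (f (cis t * z)))\<^sup>2 * K (cis t * z)) \<partial>lborel) * indicator {0..2*pi} t"
      by (subst nn_integral_multc[symmetric]) (simp_all add: K_def norm_mult)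
    also have "(\<integral>\<^sup>+z. ennreal ((cmod (f (cis t * z)))\<^sup>2 * K (cis t * z)) \<partial>lborel) = ?I"
      by (subst nn_integral_complex_rotate[of "\<lambda>z. ennreal ((cmod (f z))\<^sup>2 * K z)"])
         (simp_all add: K_def)
    finally show ?thesis .
  qed
  have circ: "(\<integral>\<^sup>+t. ?G t z \<partial>lborel)
      = ennreal (2 * pi) * (\<Sum>n. ennreal ((cmod (taylor_coeff f n))\<^sup>2)
          * ennreal (((cmod z)\<^sup>2) ^ n * mellin_kernel m ((cmod z)\<^sup>2)))" for z
  proof -
    have "(\<integral>\<^sup>+t. ?G t z \<partial>lborel)
        = (\<integral>\<^sup>+t. ennreal ((cmod (f (cis t * z)))\<^sup>2) * indicator {0..2*pi} t * ennreal (K z) \<partial>lborel)"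
      by (intro nn_integral_cong) (simp add: ennreal_mult K0 split: split_indicator)
    also have "\<dots> = (\<integral>\<^sup>+t\<in>{0..2*pi}. ennreal ((cmod (f (cis t * z)))\<^sup>2) \<partial>lborel) * ennreal (K z)"
      by (rule nn_integral_multc) measurable
    also have "\<dots> = ennreal (2 * pi)
        * (\<Sum>n. ennreal ((cmod (taylor_coeff f n))\<^sup>2 * ((cmod z)\<^sup>2) ^ n) * ennreal (K z))"
      by (simp only: nn_integral_circle_parseval[OF f] ennreal_suminf_multc mult.assoc)
    also have "(\<lambda>n. ennreal ((cmod (taylor_coeff f n))\<^sup>2 * ((cmod z)\<^sup>2) ^ n) * ennreal (K z))
        = (\<lambda>n. ennreal ((cmod (taylor_coeff f n))\<^sup>2) * ennreal (((cmod z)\<^sup>2) ^ n * mellin_kernel m ((cmod z)\<^sup>2)))"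
      by (intro ext) (simp add: ennreal_mult K0 mult.assoc mellin_kernel_nonneg flip: K_def)
    finally show ?thesis .
  qed
  have moment: "(\<integral>\<^sup>+z. ennreal (((cmod z)\<^sup>2) ^ n * mellin_kernel m ((cmod z)\<^sup>2)) \<partial>lborel)
      = ennreal pi * ennreal (fact n ^ m)" for n
    using nn_integral_complex_norm_sq[of "\<lambda>x. ennreal (x ^ n * mellin_kernel m x)"]
      nn_integral_mellin_kernel_moment[OF m, of n] by simp
  have "ennreal (2 * pi) * ?I = (\<integral>\<^sup>+t. \<integral>\<^sup>+z. ?G t z \<partial>lborel \<partial>lborel)"
    unfolding rot by (subst nn_integral_cmult_indicator) (simp_all add: mult.commute)
  also have "\<dots> = (\<integral>\<^sup>+z. \<integral>\<^sup>+t. ?G t z \<partial>lborel \<partial>lborel)"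
    by (rule lborel_pair.Fubini') measurable
  also have "\<dots> = ennreal (2 * pi) * (\<Sum>n. ennreal ((cmod (taylor_coeff f n))\<^sup>2)
      * (\<integral>\<^sup>+z. ennreal (((cmod z)\<^sup>2) ^ n * mellin_kernel m ((cmod z)\<^sup>2)) \<partial>lborel))"
    unfolding circ by (simp add: nn_integral_cmult nn_integral_suminf)
  also have "\<dots> = ennreal (2 * pi) * (\<Sum>n. ennreal pi * ?c n)"
  proof -
    have "ennreal ((cmod (taylor_coeff f n))\<^sup>2) * (ennreal pi * ennreal (fact n ^ m))
        = ennreal pi * ?c n" for n
      by (simp add: ennreal_mult' mult.left_commute)
    then show ?thesis
      unfolding moment by simp
  qed
  also have "\<dots> = ennreal (2 * pi) * (ennreal pi * suminf ?c)"
    by (simp only: ennreal_suminf_cmult)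
  \<comment> \<open>The factor 2 pi is positive and finite, so it cancels even if both sides are
    infinite.\<close>
  finally show ?thesis
    by (simp add: ennreal_mult_cancel_left)
qed

subsection \<open>The Fock space\<close>

lemma fock_space_iff_nn_integral:
  assumes "m \<ge> 1" and f: "f holomorphic_on UNIV"
  shows "f \<in> fock_space m \<longleftrightarrow>
    (\<integral>\<^sup>+z. ennreal ((cmod (f z))\<^sup>2 * mellin_kernel m ((cmod z)\<^sup>2)) \<partial>lborel) < \<infinity>"
proof -
  let ?u = "\<lambda>n. (cmod (taylor_coeff f n))\<^sup>2 * fact n ^ m"
  have "summable ?u \<longleftrightarrow> (\<Sum>n. ennreal (?u n)) \<noteq> top"
  proof
    assume "summable ?u"
    then have "(\<Sum>n. ennreal (?u n)) = ennreal (suminf ?u)"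
      by (intro suminf_ennreal2) simp_all
    then show "(\<Sum>n. ennreal (?u n)) \<noteq> top"
      by (simp only: ennreal_neq_top not_False_eq_True)
  qed (rule summable_suminf_not_top, simp_all)
  then show ?thesis
    unfolding nn_integral_mellin_kernel_norm_sq[OF assms]
    using f by (simp only: fock_space_def) (auto simp: ennreal_mult_less_top less_top)
qed

text \<open>Finite-valued form of the norm identity, to which the linearity needed for polarization
  applies.\<close>

lemma has_bochner_integral_fock_norm_sq:
  assumes "m \<ge> 1" and "f \<in> fock_space m"
  shows "has_bochner_integral lborel (\<lambda>z. (cmod (f z))\<^sup>2 * mellin_kernel m ((cmod z)\<^sup>2))
    (pi * (\<Sum>n. (cmod (taylor_coeff f n))\<^sup>2 * fact n ^ m))"
proof (rule has_bochner_integral_nn_integral)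
  let ?u = "\<lambda>n. (cmod (taylor_coeff f n))\<^sup>2 * fact n ^ m :: real"
  have f: "f holomorphic_on UNIV" and u: "summable ?u"
    using assms by (auto simp: fock_space_def)
  have [measurable]: "f \<in> borel_measurable borel"
    by (rule borel_measurable_entire[OF f])
  show "(\<lambda>z. (cmod (f z))\<^sup>2 * mellin_kernel m ((cmod z)\<^sup>2)) \<in> borel_measurable lborel"
    by measurable
  show "0 \<le> pi * suminf ?u"
    using u by (simp add: suminf_nonneg)
  show "(\<integral>\<^sup>+z. ennreal ((cmod (f z))\<^sup>2 * mellin_kernel m ((cmod z)\<^sup>2)) \<partial>lborel)
      = ennreal (pi * suminf ?u)"
    unfolding nn_integral_mellin_kernel_norm_sq[OF assms(1) f]
    using u by (subst suminf_ennreal2) (simp_all only: ennreal_mult' pi_ge_zero, simp)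
qed (simp add: mellin_kernel_nonneg)

text \<open>Applied twice: to the values of f and g under the integral, and to their Taylor
  coefficients in the series.\<close>

lemma complex_polarization:
  "a * cnj b = (1 / 4) * (\<Sum>k<4. \<i> ^ k * of_real ((cmod (a + \<i> ^ k * b))\<^sup>2))"
  by (simp only: complex_norm_square, simp add: eval_nat_numeral, simp add: algebra_simps)

section \<open>Taylor coefficients under linear operations and of polynomials\<close>

lemma taylor_coeff_add:
  assumes "f holomorphic_on UNIV" "g holomorphic_on UNIV"
  shows "taylor_coeff (\<lambda>z. f z + g z) n = taylor_coeff f n + taylor_coeff g n"
  unfolding taylor_coeff_def
  by (subst higher_deriv_add[OF assms]) (auto simp: add_divide_distrib)

lemma taylor_coeff_diff:
  assumes "f holomorphic_on UNIV" "g holomorphic_on UNIV"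
  shows "taylor_coeff (\<lambda>z. f z - g z) n = taylor_coeff f n - taylor_coeff g n"
  unfolding taylor_coeff_def
  by (subst higher_deriv_diff[OF assms]) (auto simp: diff_divide_distrib)

lemma taylor_coeff_cmult:
  assumes "f holomorphic_on UNIV"
  shows "taylor_coeff (\<lambda>z. c * f z) n = c * taylor_coeff f n"
  unfolding taylor_coeff_def by (subst higher_deriv_cmult[OF assms]) auto

lemma taylor_coeff_power: "taylor_coeff (\<lambda>z. z ^ n) k = (if k = n then 1 else 0)"
  \<comment> \<open>At 0 a positive power of z remains for k < n, the Pochhammer factor starts at 0
    for k > n, and for k = n it equals n!.\<close>
  using higher_deriv_power[of k "0::complex" n 0]
  by (auto simp: taylor_coeff_def pochhammer_fact[symmetric] pochhammer_0_left not_less_eq)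

lemma taylor_coeff_poly: "taylor_coeff (\<lambda>z. \<Sum>n<N. c n * z ^ n) k = (if k < N then c k else 0)"
proof (induction N)
  case 0
  show ?case
    \<comment> \<open>The empty sum is treated as the multiple 0 * z of the identity.\<close>
    using taylor_coeff_cmult[of "\<lambda>z. z" 0 k] by (simp add: holomorphic_on_ident)
next
  case (Suc N)
  have "taylor_coeff (\<lambda>z. (\<Sum>n<N. c n * z ^ n) + c N * z ^ N) k
      = taylor_coeff (\<lambda>z. \<Sum>n<N. c n * z ^ n) k + c N * taylor_coeff (\<lambda>z. z ^ N) k"
    by (subst taylor_coeff_add, (intro holomorphic_intros)+, subst taylor_coeff_cmult,
        (intro holomorphic_intros)+) simp
  with Suc show ?case
    by (auto simp: taylor_coeff_power less_Suc_eq)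
qed

text \<open>The four functions \<open>h k\<close> = f + i^k g lie in the space by linearity.
  Polarizing their norm identities gives the integral on one side and the coefficient series on the
  other.\<close>

lemma has_bochner_integral_fock_inner:
  assumes m: "m \<ge> 1" and f: "f \<in> fock_space m" and g: "g \<in> fock_space m"
  shows "has_bochner_integral lborel
    (\<lambda>z. f z * cnj (g z) * complex_of_real (mellin_kernel m ((cmod z)\<^sup>2)))
    (of_real pi * fock_inner m f g)"
proof -
  define h where "h k z = f z + \<i> ^ k * g z" for k :: nat and z
  define S where "S k = (\<Sum>n. (cmod (taylor_coeff (h k) n))\<^sup>2 * fact n ^ m)" for k
  have h: "h k \<in> fock_space m" for k
    unfolding h_def by (intro fock_space_add fock_space_cmult f g)
  have hol: "f holomorphic_on UNIV" "g holomorphic_on UNIV"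
    using f g by (auto simp: fock_space_def)
  have coeff: "taylor_coeff (h k) n = taylor_coeff f n + \<i> ^ k * taylor_coeff g n" for k n
    unfolding h_def using hol by (simp add: taylor_coeff_add taylor_coeff_cmult holomorphic_on_mult)
  have "has_bochner_integral lborel
      (\<lambda>z. (1 / 4) * (\<Sum>k<4. \<i> ^ k * of_real ((cmod (h k z))\<^sup>2 * mellin_kernel m ((cmod z)\<^sup>2))))
      ((1 / 4) * (\<Sum>k<4. \<i> ^ k * of_real (pi * S k)))"
    unfolding S_def
    by (intro has_bochner_integral_mult_right has_bochner_integral_sum
        has_bochner_integral_of_real has_bochner_integral_fock_norm_sq m h)
  moreover have "(1 / 4) * (\<Sum>k<4. \<i> ^ k * of_real ((cmod (h k z))\<^sup>2 * mellin_kernel m ((cmod z)\<^sup>2)))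
      = f z * cnj (g z) * of_real (mellin_kernel m ((cmod z)\<^sup>2))" for z
    unfolding complex_polarization[of "f z"] h_def by (simp add: sum_distrib_right mult.assoc)
  moreover have "(1 / 4) * (\<Sum>k<4. \<i> ^ k * of_real (pi * S k)) = of_real pi * fock_inner m f g"
  proof -
    have "(\<lambda>n. (1 / 4) * (\<Sum>k<4. \<i> ^ k * complex_of_real ((cmod (taylor_coeff (h k) n))\<^sup>2 * fact n ^ m)))
        sums ((1 / 4) * (\<Sum>k<4. \<i> ^ k * complex_of_real (S k)))"
      unfolding S_def using h
      by (intro sums_mult sums_sum sums_of_real summable_sums) (simp add: fock_space_def)
    moreover have "(1 / 4) * (\<Sum>k<4. \<i> ^ k * of_real ((cmod (taylor_coeff (h k) n))\<^sup>2 * fact n ^ m))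
        = taylor_coeff f n * cnj (taylor_coeff g n) * fact n ^ m" for n
      unfolding complex_polarization[of "taylor_coeff f n"] coeff
      by (simp add: sum_distrib_right mult.assoc)
    ultimately have "fock_inner m f g = (1 / 4) * (\<Sum>k<4. \<i> ^ k * complex_of_real (S k))"
      unfolding fock_inner_def by (simp only: sums_iff)
    then show ?thesis
      by (simp add: sum_distrib_left mult_ac)
  qed
  ultimately show ?thesis by simp
qed

section \<open>The normalized monomials\<close>

lemma fact_powr_half_sq:
  "complex_of_real (fact n powr (real m / 2)) * complex_of_real (fact n powr (real m / 2)) = fact n ^ m"
  by (simp add: powr_realpow flip: of_real_mult powr_add)

text \<open>Orthonormality holds because each monomial has a single nonzero coefficient. For
  density, f is approximated by its Taylor polynomials: the squared norm of the remainder is the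
  tail of the convergent series defining membership.\<close>

lemma orthonormal_basis_monomials:
  "orthonormal_basis (fock_space m) (fock_inner m)
     (\<lambda>n z. z ^ n / complex_of_real (fact n powr (real m / 2)))"
proof -
  define w where "w n = complex_of_real (fact n powr (real m / 2))" for n :: nat
  have w: "w n * w n = fact n ^ m" "w n \<noteq> 0" "cnj (w n) = w n" for n
    by (simp_all add: w_def fact_powr_half_sq)
  define e where "e n z = z ^ n / w n" for n z
  have coeff: "taylor_coeff (e n) k = (if k = n then 1 / w n else 0)" for n k
    using taylor_coeff_cmult[of "\<lambda>z. z ^ n" "1 / w n" k]
    by (simp add: e_def[abs_def] taylor_coeff_power holomorphic_intros)
  have "e n \<in> fock_space m" for n
  proof -
    have "summable (\<lambda>k. (cmod (taylor_coeff (e n) k))\<^sup>2 * fact k ^ m)"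
      by (rule summable_finite[of "{n}"]) (auto simp: coeff)
    moreover have "e n holomorphic_on UNIV"
      unfolding e_def[abs_def] using w by (intro holomorphic_intros) auto
    ultimately show ?thesis
      by (simp add: fock_space_def)
  qed
  moreover have "fock_inner m (e i) (e j) = (if i = j then 1 else 0)" for i j
  proof -
    have "fock_inner m (e i) (e j)
        = (\<Sum>k\<in>{i}. taylor_coeff (e i) k * cnj (taylor_coeff (e j) k) * fact k ^ m)"
      unfolding fock_inner_def by (rule suminf_finite) (auto simp: coeff)
    then show ?thesis
      using w(2) by (cases "i = j") (simp_all add: coeff w(3) flip: w(1))
  qed
  moreover have "\<exists>N c. let d = (\<lambda>z. f z - (\<Sum>n<N. c n * e n z))
      in sqrt (Re (fock_inner m d d)) < \<epsilon>"
    if f: "f \<in> fock_space m" and "\<epsilon> > 0" for f \<epsilon>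
  proof -
    define u where "u k = (cmod (taylor_coeff f k))\<^sup>2 * fact k ^ m" for k
    have hol: "f holomorphic_on UNIV" and u: "summable u"
      using f by (auto simp: fock_space_def u_def[abs_def])
    \<comment> \<open>The tail is made smaller than \<epsilon>^2 because the distance is its square
      root.\<close>
    obtain N where N: "norm (\<Sum>k. u (k + N)) < \<epsilon>\<^sup>2"
      using suminf_exist_split[of "\<epsilon>\<^sup>2" u] u \<open>\<epsilon> > 0\<close> by auto
    \<comment> \<open>The factor \<open>w n\<close> undoes the normalization of \<open>e n\<close>,
      so the combination is exactly the Taylor polynomial of f.\<close>
    define c where "c n = taylor_coeff f n * w n" for n
    define d where "d z = f z - (\<Sum>n<N. c n * e n z)" for z
    have "d = (\<lambda>z. f z - (\<Sum>n<N. taylor_coeff f n * z ^ n))"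
      using w(2) by (simp add: d_def[abs_def] c_def e_def)
    then have d: "taylor_coeff d k = (if k < N then 0 else taylor_coeff f k)" for k
      by (simp add: taylor_coeff_diff hol holomorphic_intros taylor_coeff_poly)
    let ?v = "\<lambda>k. if k < N then 0 else u k"
    have v: "summable ?v"
    proof -
      have "eventually (\<lambda>k. ?v k = u k) sequentially"
        using eventually_ge_at_top[of N] by eventually_elim simp
      from summable_cong[OF this] u show ?thesis by simp
    qed
    have "fock_inner m d d = (\<Sum>k. of_real (?v k))"
      unfolding fock_inner_def d u_def
      by (intro suminf_cong) (simp flip: complex_norm_square)
    also have "\<dots> = of_real (\<Sum>k. ?v k)"
      by (rule suminf_of_real[OF v, symmetric])
    also have "(\<Sum>k. ?v k) = (\<Sum>k. u (k + N))"
      by (subst suminf_split_initial_segment[OF v, of N]) simp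
    finally have "sqrt (Re (fock_inner m d d)) < \<epsilon>"
      using N \<open>\<epsilon> > 0\<close> by (intro real_less_lsqrt) auto
    then show ?thesis
      unfolding Let_def d_def[abs_def] by blast
  qed
  ultimately have "orthonormal_basis (fock_space m) (fock_inner m) e"
    unfolding orthonormal_basis_def by blast
  then show ?thesis
    by (simp add: e_def[abs_def] w_def)
qed

theorem theorem3p2:
  fixes m :: nat
  assumes "m \<ge> 1"
  shows
    "fock_space m =
       {f. f holomorphic_on UNIV \<and>
           (\<integral>\<^sup>+ z. ennreal ((cmod (f z))\<^sup>2 * mellin_kernel m ((cmod z)\<^sup>2)) \<partial>lborel) < \<infinity>}
     \<and> (\<forall>f\<in>fock_space m. \<forall>g\<in>fock_space m.
          integrable lborel
            (\<lambda>z. f z * cnj (g z) * complex_of_real (mellin_kernel m ((cmod z)\<^sup>2)))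
        \<and> fock_inner m f g = complex_of_real (1 / pi) *
            (LINT z|lborel. f z * cnj (g z) * complex_of_real (mellin_kernel m ((cmod z)\<^sup>2)))
        \<and> (\<lambda>n. taylor_coeff f n * cnj (taylor_coeff g n) * (fact n) ^ m) sums fock_inner m f g)
     \<and> orthonormal_basis (fock_space m) (fock_inner m)
          (\<lambda>n z. z ^ n / complex_of_real (fact n powr (real m / 2)))"
proof (intro conjI ballI)
  show "fock_space m = {f. f holomorphic_on UNIV \<and>
      (\<integral>\<^sup>+ z. ennreal ((cmod (f z))\<^sup>2 * mellin_kernel m ((cmod z)\<^sup>2)) \<partial>lborel) < \<infinity>}"
    using fock_space_iff_nn_integral[OF assms] by (auto simp: fock_space_def)
next
  fix f g
  assume fg: "f \<in> fock_space m" "g \<in> fock_space m"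
  note I = has_bochner_integral_fock_inner[OF assms fg]
  show "integrable lborel
      (\<lambda>z. f z * cnj (g z) * complex_of_real (mellin_kernel m ((cmod z)\<^sup>2)))"
    using I by (rule integrable.intros)
  show "fock_inner m f g = complex_of_real (1 / pi) *
      (LINT z|lborel. f z * cnj (g z) * complex_of_real (mellin_kernel m ((cmod z)\<^sup>2)))"
    using has_bochner_integral_integral_eq[OF I] by simp
  show "(\<lambda>n. taylor_coeff f n * cnj (taylor_coeff g n) * (fact n) ^ m) sums fock_inner m f g"
    unfolding fock_inner_def using fock_inner_summable[OF fg] by (rule summable_sums)
qed (rule orthonormal_basis_monomials)

end
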